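(* For every hypergraph $\mathcal{C}$ we have $\operatorname{conn}(\operatorname{Ind}(\mathcal{C})) \geq \psi(\mathcal{C}) - 2$.
   Context: A hypergraph $\mathcal{C}$ on a finite vertex set $V$ is a family of pairwise incomparable subsets of $V$ (its edges), each of cardinality at least $2$; vertices lying in no edge are allowed (isolated vertices). The independence complex $\operatorname{Ind}(\mathcal{C})$ is the simplicial complex on $V$ whose faces are the subsets of $V$ containing no edge of $\mathcal{C}$ (if $V=\emptyset$ it is the complex $\{\emptyset\}$). For an edge $F$ of $\mathcal{C}$: $\mathcal{C}-F$ is the hypergraph on $V$ with edge set $\mathcal{C}\setminus\{F\}$; $N_{\mathcal{C}}(F)=\bigcup\{E\setminus F : E\in\mathcal{C},\ |E\setminus F|=1\}$; and $\mathcal{C}:F$ is the hypergraph on $V\setminus(F\cup N_{\mathcal{C}}(F))$ whose edges are the members of cardinality at least $2$ among the inclusion-minimal members of the family $\{E\setminus F : E\in \mathcal{C}-F\}$ (equivalently, $\operatorname{Ind}(\mathcal{C}:F)$ is the link of $F$ in $\operatorname{Ind}(\mathcal{C}-F)$). The number $\psi(\mathcal{C})\in\mathbb{Z}_{\ge 0}\cup\{\infty\}$ is defined recursively: $\psi(\mathcal{C})=0$ if $V=\emptyset$; $\psi(\mathcal{C})=\infty$ if $V\neq\emptyset$ and $\mathcal{C}$ has no edges; otherwise $\psi(\mathcal{C})=\max_{F\in\mathcal{C}}\min\{\psi(\mathcal{C}-F),\ \psi(\mathcal{C}:F)+|F|-1\}$. The homotopical connectivity $\operatorname{conn}(\Delta)$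 of a simplicial complex $\Delta$ is the largest integer $k\ge -1$ such that $\Delta$ is nonempty (has a vertex) and $\pi_i(\Delta)=0$ for all $0\le i\le k$; it is $\infty$ if all homotopy groups vanish, and $\operatorname{conn}(\{\emptyset\})=-2$. *)

theory Defs
  imports "HOL-Analysis.Analysis" "HOL-Library.Extended_Nat"
begin

definition hypergraph :: "'a set \<Rightarrow> 'a set set \<Rightarrow> bool" where
  "hypergraph V C \<longleftrightarrow> finite V \<and> (\<forall>E\<in>C. E \<subseteq> V \<and> 2 \<le> card E)
     \<and> (\<forall>E\<in>C. \<forall>E'\<in>C. E \<subseteq> E' \<longrightarrow> E = E')"

definition Ind :: "'a set \<Rightarrow> 'a set set \<Rightarrow> 'a set set" where
  "Ind V C = {\<sigma>. \<sigma> \<subseteq> V \<and> (\<forall>E\<in>C. \<not> E \<subseteq> \<sigma>)}"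

definition nbhd :: "'a set set \<Rightarrow> 'a set \<Rightarrow> 'a set" where
  "nbhd C F = \<Union>{E - F | E. E \<in> C \<and> card (E - F) = 1}"

text \<open>Edge set of C:F (its vertex set is V - (F \<union> nbhd C F)).\<close>
definition colon :: "'a set set \<Rightarrow> 'a set \<Rightarrow> 'a set set" where
  "colon C F = (let D = {E - F | E. E \<in> C - {F}} in
     {G \<in> D. (\<forall>G'\<in>D. G' \<subseteq> G \<longrightarrow> G' = G) \<and> 2 \<le> card G})"

text \<open>The recursion for psi, with a fuel argument; the fuel card V + card C + 1
  used below always suffices (each recursive call decreases card V + card C).\<close>
primrec psi_aux :: "nat \<Rightarrow> 'a set \<Rightarrow> 'a set set \<Rightarrow> enat" where
  "psi_aux 0 V C = 0"
| "psi_aux (Suc n) V C =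
     (if V = {} then 0
      else if C = {} then \<infinity>
      else Max ((\<lambda>F. min (psi_aux n V (C - {F}))
                         (psi_aux n (V - (F \<union> nbhd C F)) (colon C F) + enat (card F - 1))) ` C))"

definition psi :: "'a set \<Rightarrow> 'a set set \<Rightarrow> enat" where
  "psi V C = psi_aux (card V + card C + 1) V C"

definition realization :: "'a set \<Rightarrow> 'a set set \<Rightarrow> ('a \<Rightarrow> real) set" where
  "realization V K = {x. (\<forall>v. 0 \<le> x v) \<and> (\<forall>v. v \<notin> V \<longrightarrow> x v = 0)
      \<and> sum x V = 1 \<and> {v. x v \<noteq> 0} \<in> K}"

text \<open>The (d-1)-sphere and the d-disc inside R^d, embedded in nat \<Rightarrow> real.\<close>
definition sphere_d :: "nat \<Rightarrow> (nat \<Rightarrow> real) set" where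
  "sphere_d d = {x. (\<forall>j\<ge>d. x j = 0) \<and> (\<Sum>j<d. (x j)\<^sup>2) = 1}"
definition disc_d :: "nat \<Rightarrow> (nat \<Rightarrow> real) set" where
  "disc_d d = {x. (\<forall>j\<ge>d. x j = 0) \<and> (\<Sum>j<d. (x j)\<^sup>2) \<le> 1}"

text \<open>pi_i(X) = 0 (for all base points): every map S^i \<rightarrow> X is
  nullhomotopic, i.e. extends to the disc D^(i+1).\<close>
definition pi_trivial :: "nat \<Rightarrow> 'b::topological_space set \<Rightarrow> bool" where
  "pi_trivial i X \<longleftrightarrow> (\<forall>f. continuous_map (top_of_set (sphere_d (Suc i))) (top_of_set X) f \<longrightarrow>
      (\<exists>g. continuous_map (top_of_set (disc_d (Suc i))) (top_of_set X) g
           \<and> (\<forall>x\<in>sphere_d (Suc i). g x = f x)))"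

text \<open>conn(|K|) \<ge> k, with the conventions conn({\<emptyset>}) = -2.\<close>
definition conn_ge :: "'a set \<Rightarrow> 'a set set \<Rightarrow> int \<Rightarrow> bool" where
  "conn_ge V K k \<longleftrightarrow> k \<le> -2 \<or>
     (realization V K \<noteq> {} \<and> (\<forall>i::nat. int i \<le> k \<longrightarrow> pi_trivial i (realization V K)))"

end

(* Connectivity is replaced by an extension property: a space is an n-extensor if maps into it from
   closed subsets of compact sets of dimension less than n (cut out of a Euclidean space by "many
   coordinates lie in a countable set") extend.  An (i+2)-extensor has trivial homotopy in degree i,
   as the (i+1)-disc has dimension i + 1, and no triangulation or general position is needed:

   - Let F be an edge, Y = Ind (C - F), X = Ind C and B = F * Ind (C:F), so that Y is the union of X
     and B, which meet in D, the join of the boundary of F with Ind (C:F).  If Y and D are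
     n-extensors, so is X: extend a map into X first to Y, and then replace it on the preimage of B
     by an extension, into D, of its restriction to the preimage of D.
   - D arises from Ind (C:F) by card F - 1 suspensions.  A suspension of an n-extensor is an
     (n+1)-extensor, because disjoint closed subsets of a set of dimension n are separated by
     a set of dimension n - 1.
   - Cones are retracts of the whole function space, hence n-extensors for all n. *)

theory Submission
  imports Defs
begin

subsection \<open>Dimension and extension of maps\<close>

text \<open>The condition \<open>thin n S\<close> expresses that \<open>S\<close> has dimension less than \<open>n\<close>: of the \<open>m\<close>
  coordinates, more than \<open>m - n\<close> are confined to a countable set.\<close>

definition thin :: "nat \<Rightarrow> (nat \<Rightarrow> real) set \<Rightarrow> bool" where
  "thin n S \<longleftrightarrow> compact S \<and> (\<exists>m G. countable G \<and>
     (\<forall>x\<in>S. (\<forall>j\<ge>m. x j = 0) \<and> m < n + card {j. j < m \<and> x j \<in> G}))"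

lemma thin_0:
  assumes "thin 0 S"
  shows "S = {}"
proof (rule ccontr)
  assume "S \<noteq> {}"
  with assms obtain x m G where "m < card {j. j < m \<and> x j \<in> (G :: real set)}"
    unfolding thin_def by force
  moreover have "card {j. j < m \<and> x j \<in> G} \<le> m"
    using card_mono[of "{..<m}" "{j. j < m \<and> x j \<in> G}"] by auto
  ultimately show False by simp
qed

lemma thin_subset: "thin n S \<Longrightarrow> closed T \<Longrightarrow> T \<subseteq> S \<Longrightarrow> thin n T"
  unfolding thin_def by (metis compact_Int_closed inf.absorb_iff2 subsetD)

lemma thin_mono: "thin n S \<Longrightarrow> n \<le> k \<Longrightarrow> thin k S"
  unfolding thin_def by (meson add_le_mono1 less_le_trans)

lemma thin_closed: "thin n S \<Longrightarrow> closed S"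
  by (simp add: thin_def compact_imp_closed)

section \<open>Separation of disjoint closed subsets of a thin set\<close>

lemma open_coordinate_box:
  fixes U :: "nat \<Rightarrow> real set"
  assumes "\<And>j. j < m \<Longrightarrow> open (U j)"
  shows "open {y. \<forall>j<m. y j \<in> U j}"
proof -
  have "open (\<Inter>j\<in>{..<m}. (\<lambda>y. y j) -` U j)"
    using assms by (intro open_INT) (auto intro!: open_vimage)
  also have "(\<Inter>j\<in>{..<m}. (\<lambda>y. y j) -` U j) = {y. \<forall>j<m. y j \<in> U j}"
    by auto
  finally show ?thesis .
qed

text \<open>The sum of the first \<open>m\<close> coordinate differences attains its minimum on the
  compact set \<open>X \<times> Y\<close>. It is positive because the sets are disjoint and all
  further coordinates vanish.\<close>

lemma coordinate_gap:
  fixes X Y :: "(nat \<Rightarrow> real) set"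
  assumes "compact X" "compact Y" "X \<inter> Y = {}"
    and supp: "\<And>x j. x \<in> X \<union> Y \<Longrightarrow> j \<ge> m \<Longrightarrow> x j = 0"
  obtains d where "d > 0" "\<And>x y. x \<in> X \<Longrightarrow> y \<in> Y \<Longrightarrow> \<exists>j<m. d \<le> \<bar>x j - y j\<bar>"
proof (cases "X = {} \<or> Y = {}")
  case True
  then show ?thesis using that[of 1] by auto
next
  case False
  define \<phi> where "\<phi> p = (\<Sum>j<m. \<bar>fst p j - snd p j\<bar>)" for p :: "(nat \<Rightarrow> real) \<times> (nat \<Rightarrow> real)"
  have "continuous_on (X \<times> Y) (\<lambda>p. fst p j)" "continuous_on (X \<times> Y) (\<lambda>p. snd p j)" for j
    by (rule continuous_on_product_then_coordinatewise,
        simp add: continuous_on_fst continuous_on_snd continuous_on_id)+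
  then have "continuous_on (X \<times> Y) \<phi>"
    unfolding \<phi>_def by (intro continuous_on_sum continuous_on_rabs continuous_on_diff)
  moreover have "compact (X \<times> Y)" "X \<times> Y \<noteq> {}"
    using assms False by (auto intro: compact_Times)
  ultimately obtain p where p: "p \<in> X \<times> Y" "\<And>q. q \<in> X \<times> Y \<Longrightarrow> \<phi> p \<le> \<phi> q"
    using continuous_attains_inf[of "X \<times> Y" \<phi>] by auto
  have ge: "\<phi> p \<ge> 0" unfolding \<phi>_def by (simp add: sum_nonneg)
  have "\<phi> p \<noteq> 0"
  proof
    assume "\<phi> p = 0"
    then have "\<forall>j<m. fst p j = snd p j"
      unfolding \<phi>_def by (subst (asm) sum_nonneg_eq_0_iff) auto
    moreover have "fst p j = snd p j" if "j \<ge> m" for j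
      using supp[of "fst p" j] supp[of "snd p" j] p(1) that by auto
    ultimately have "fst p = snd p" by (metis ext not_le)
    then show False using p(1) assms(3) by auto
  qed
  with ge have pos: "\<phi> p > 0" by simp
  show ?thesis
  \<comment> \<open>Dividing by \<open>m + 1\<close> keeps the sum of \<open>m\<close> such terms
    strictly below \<open>\<phi> p\<close>, also for \<open>m = 0\<close>.\<close>
  proof (rule that[of "\<phi> p / (real m + 1)"])
    show "\<phi> p / (real m + 1) > 0" using pos by simp
    fix x y assume xy: "x \<in> X" "y \<in> Y"
    show "\<exists>j<m. \<phi> p / (real m + 1) \<le> \<bar>x j - y j\<bar>"
    proof (rule ccontr)
      assume "\<not> ?thesis"
      then have "\<phi> (x, y) \<le> (\<Sum>j<m. \<phi> p / (real m + 1))"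
        unfolding \<phi>_def by (intro sum_mono) (auto simp: \<phi>_def)
      also have "\<dots> < \<phi> p" using pos by (simp add: field_simps)
      finally show False using p(2)[of "(x, y)"] xy by auto
    qed
  qed
qed

text \<open>Each pair of an element of \<open>G\<close> and an integer \<open>k\<close> excludes one
  value of \<open>\<theta>\<close>, hence only countably many are excluded.\<close>

lemma grid_avoiding_countable:
  fixes G :: "real set"
  assumes "countable G"
  obtains \<theta> where "\<And>k::int. \<theta> + k * e \<notin> G"
proof -
  have "countable ((\<lambda>(g, k::int). g - k * e) ` (G \<times> UNIV))"
    using assms by (intro countable_image countable_SIGMA) auto
  then obtain \<theta> where \<theta>: "\<theta> \<notin> (\<lambda>(g, k::int). g - k * e) ` (G \<times> UNIV)"
    using uncountable_UNIV_real by (metis UNIV_eq_I)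
  have "\<theta> + k * e \<notin> G" for k :: int
  proof
    assume "\<theta> + k * e \<in> G"
    then have "\<theta> \<in> (\<lambda>(g, k::int). g - k * e) ` (G \<times> UNIV)"
      by (intro image_eqI[of _ _ "(\<theta> + k * e, k)"]) auto
    with \<theta> show False by blast
  qed
  then show ?thesis by (rule that)
qed

text \<open>A partition along the walls of a fine grid: on a wall, one further coordinate is confined
  to a countable set, and choosing the grid disjoint from the old countable set makes this
  coordinate a new one.\<close>

lemma thin_separation:
  assumes "thin (Suc n) S" "closed X" "closed Y" "X \<subseteq> S" "Y \<subseteq> S" "X \<inter> Y = {}"
  obtains A B where "closed A" "closed B" "A \<union> B = S" "A \<inter> Y = {}" "B \<inter> X = {}"
    "thin n (A \<inter> B)"
proof -
  from assms(1) obtain m G where cS: "compact S" and G: "countable G"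
    and S: "\<And>x j. x \<in> S \<Longrightarrow> j \<ge> m \<Longrightarrow> x j = 0"
           "\<And>x. x \<in> S \<Longrightarrow> m < Suc n + card {j. j < m \<and> x j \<in> G}"
    unfolding thin_def by metis
  have cX: "compact X" and cY: "compact Y"
    using cS assms by (metis compact_Int_closed inf.absorb_iff2)+
  obtain d where d: "d > 0" "\<And>x y. x \<in> X \<Longrightarrow> y \<in> Y \<Longrightarrow> \<exists>j<m. d \<le> \<bar>x j - y j\<bar>"
    using coordinate_gap[OF cX cY assms(6), of m] S(1) assms(4,5) by (metis Un_iff subsetD)
  \<comment> \<open>Points in touching grid cells differ by less than \<open>2 * e\<close> in each
    coordinate, and passing to the closure costs another \<open>e\<close>; together this stays below
    \<open>d\<close>.\<close>
  define e where "e = d / 3"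
  have e: "e > 0" using d by (simp add: e_def)
  obtain \<theta> where \<theta>: "\<And>k::int. \<theta> + k * e \<notin> G"
    using grid_avoiding_countable[OF G] by metis
  define c where "c t = \<lfloor>(t - \<theta>) / e\<rfloor>" for t
  have c_bounds: "\<theta> + c t * e \<le> t" "t < \<theta> + (c t + 1) * e" for t
  proof -
    have "real_of_int (c t) \<le> (t - \<theta>) / e" "(t - \<theta>) / e < real_of_int (c t) + 1"
      unfolding c_def by linarith+
    with e show "\<theta> + c t * e \<le> t" "t < \<theta> + (c t + 1) * e"
      by (simp_all add: field_simps)
  qed
  have c_eqI: "c s = k" if "\<theta> + k * e \<le> s" "s < \<theta> + (k + 1) * e" for s and k :: int
    unfolding c_def using that e by (intro floor_unique) (simp_all add: field_simps)
  have c_near: "\<bar>c s - c t\<bar> \<le> 1" if "\<bar>s - t\<bar> < e" for s t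
  proof -
    have "\<bar>(s - \<theta>) / e - (t - \<theta>) / e\<bar> < 1"
      using that e by (simp add: diff_divide_distrib[symmetric])
    then show ?thesis unfolding c_def by linarith
  qed
  have c_far: "\<bar>s - t\<bar> < 2 * e" if "\<bar>c s - c t\<bar> \<le> 1" for s t
  proof -
    have "\<bar>real_of_int (c s) - c t\<bar> \<le> 1" using that by linarith
    then have "\<bar>(c s - c t) * e\<bar> \<le> e" using e by (simp add: abs_mult)
    then have "c s * e - c t * e \<le> e" "c t * e - c s * e \<le> e"
      by (auto simp: abs_le_iff algebra_simps)
    moreover have "\<theta> + c s * e \<le> s" "s < \<theta> + c s * e + e" "\<theta> + c t * e \<le> t" "t < \<theta> + c t * e + e"
      using c_bounds[of s] c_bounds[of t] by (simp_all add: algebra_simps)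
    ultimately show ?thesis by linarith
  qed
  \<comment> \<open>The cell of \<open>x\<close> equals or touches a cell that meets
    \<open>X\<close>. This depends on the cell only, so it can change only across walls.\<close>
  define a where "a x \<longleftrightarrow> (\<exists>z\<in>X. \<forall>j<m. \<bar>c (x j) - c (z j)\<bar> \<le> 1)" for x
  define A where "A = closure {x\<in>S. a x}"
  define B where "B = closure {x\<in>S. \<not> a x}"
  have "A \<union> B = closure S"
    unfolding A_def B_def closure_Un[symmetric] by (rule arg_cong[of _ _ closure]) auto
  then have AB: "A \<union> B = S" using cS by (simp add: compact_imp_closed closure_closed)
  have box: "open {x. \<forall>j<m. \<bar>x j - y j\<bar> < e}" for y :: "nat \<Rightarrow> real"
  proof -
    have "{x. \<forall>j<m. \<bar>x j - y j\<bar> < e} = {x. \<forall>j<m. x j \<in> {y j - e<..<y j + e}}"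
      by (auto simp: abs_less_iff algebra_simps)
    then show ?thesis
      using open_coordinate_box[of m "\<lambda>j. {y j - e<..<y j + e}"] by simp
  qed
  have meets: "\<exists>x\<in>U. x \<in> T" if "y \<in> closure T" "open U" "y \<in> U" for y U and T :: "(nat \<Rightarrow> real) set"
    using that by (metis Int_emptyI open_Int_closure_eq_empty disjoint_iff)
  have "A \<inter> Y = {}"
  proof (rule ccontr)
    assume "A \<inter> Y \<noteq> {}"
    then obtain y where y: "y \<in> A" "y \<in> Y" by auto
    obtain x where x: "\<forall>j<m. \<bar>x j - y j\<bar> < e" "a x"
      using meets[OF y(1)[unfolded A_def] box[of y]] e by auto
    then obtain z where z: "z \<in> X" "\<forall>j<m. \<bar>x j - z j\<bar> < 2 * e"
      unfolding a_def using c_far by blast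
    have "\<bar>z j - y j\<bar> < d" if "j < m" for j
    proof -
      have "\<bar>x j - y j\<bar> < e" "\<bar>x j - z j\<bar> < 2 * e" using x(1) z(2) that by auto
      then show ?thesis unfolding e_def by linarith
    qed
    then show False using d(2)[OF z(1) y(2)] by force
  qed
  moreover have "B \<inter> X = {}"
  proof (rule ccontr)
    assume "B \<inter> X \<noteq> {}"
    then obtain x where x: "x \<in> B" "x \<in> X" by auto
    obtain y where "\<forall>j<m. \<bar>y j - x j\<bar> < e" "\<not> a y"
      using meets[OF x(1)[unfolded B_def] box[of x]] e by auto
    then show False using c_near x(2) unfolding a_def by blast
  qed
  moreover have "thin n (A \<inter> B)"
  proof -
    define H where "H = range (\<lambda>k::int. \<theta> + k * e)"
    \<comment> \<open>Off the walls, \<open>x\<close> has an open cell as neighbourhood; both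
      closures would force it to meet both sets, although \<open>a\<close> is constant
      there.\<close>
    have wall: "\<exists>j<m. x j \<in> H" if x: "x \<in> A" "x \<in> B" for x
    proof (rule ccontr)
      assume *: "\<not> ?thesis"
      define U where "U = {y. \<forall>j<m. y j \<in> {\<theta> + c (x j) * e<..<\<theta> + (c (x j) + 1) * e}}"
      have "open U" unfolding U_def by (intro open_coordinate_box) auto
      moreover have "\<theta> + c (x j) * e \<noteq> x j" if "j < m" for j
        using * that unfolding H_def by (metis rangeI)
      then have "x \<in> U"
        using c_bounds unfolding U_def by (auto simp: less_le)
      ultimately obtain y y' where y: "y \<in> U" "a y" "y' \<in> U" "\<not> a y'"
        using meets[of x "{x\<in>S. a x}" U] meets[of x "{x\<in>S. \<not> a x}" U] x unfolding A_def B_def by auto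
      have "c (y j) = c (y' j)" if "j < m" for j
      proof -
        have "c (y j) = c (x j)" "c (y' j) = c (x j)"
          using y(1,3) that unfolding U_def by (auto intro!: c_eqI less_imp_le)
        then show ?thesis by simp
      qed
      then have "a y = a y'" unfolding a_def by auto
      then show False using y(2,4) by simp
    qed
    have "m < n + card {j. j < m \<and> x j \<in> G \<union> H}" if x: "x \<in> A" "x \<in> B" for x
    proof -
      obtain j where j: "j < m" "x j \<in> H" using wall[OF x] by auto
      then have "x j \<notin> G" using \<theta> by (auto simp: H_def)
      have "Suc (card {j. j < m \<and> x j \<in> G}) = card (insert j {j. j < m \<and> x j \<in> G})"
        using \<open>x j \<notin> G\<close> by simp
      also have "\<dots> \<le> card {j. j < m \<and> x j \<in> G \<union> H}"
        using j by (intro card_mono) auto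
      finally show ?thesis using S(2)[of x] AB x by auto
    qed
    moreover have "countable (G \<union> H)" using G by (auto simp: H_def)
    moreover have "compact (A \<inter> B)"
    proof -
      have "A \<inter> B = S \<inter> (A \<inter> B)" using AB by auto
      moreover have "closed (A \<inter> B)" by (simp add: A_def B_def closed_Int)
      ultimately show ?thesis using compact_Int_closed[OF cS] by metis
    qed
    ultimately show ?thesis
      unfolding thin_def using S(1) AB by blast
  qed
  ultimately show ?thesis using that[of A B] AB by (auto simp: A_def B_def)
qed

section \<open>Extensors and how they are obtained\<close>

definition extensor :: "nat \<Rightarrow> 'b::topological_space set \<Rightarrow> bool" where
  "extensor n D \<longleftrightarrow> (\<forall>S Q f. thin n S \<longrightarrow> closed Q \<longrightarrow> Q \<subseteq> S \<longrightarrow> continuous_on Q f \<longrightarrow> f ` Q \<subseteq> D \<longrightarrow>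
     (\<exists>g. continuous_on S g \<and> g ` S \<subseteq> D \<and> (\<forall>x\<in>Q. g x = f x)))"

lemma extensorE:
  assumes "extensor n D" "thin n S" "closed Q" "Q \<subseteq> S" "continuous_on Q f" "f ` Q \<subseteq> D"
  obtains g where "continuous_on S g" "g ` S \<subseteq> D" "\<And>x. x \<in> Q \<Longrightarrow> g x = f x"
  using assms unfolding extensor_def by metis

lemma extensor_0: "extensor 0 D"
  unfolding extensor_def by (auto dest!: thin_0)

lemma extensor_mono: "extensor n D \<Longrightarrow> k \<le> n \<Longrightarrow> extensor k D"
  unfolding extensor_def by (meson thin_mono)

text \<open>Each coordinate extends as a real function, and the retraction brings the resulting map
  back into \<open>D\<close>.\<close>

lemma extensor_retract:
  fixes D :: "('a \<Rightarrow> real) set"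
  assumes "D retract_of UNIV"
  shows "extensor n D"
  unfolding extensor_def
proof (intro allI impI)
  fix S Q and f :: "(nat \<Rightarrow> real) \<Rightarrow> 'a \<Rightarrow> real"
  assume S: "thin n S" and Q: "closed Q" "Q \<subseteq> S" and f: "continuous_on Q f" "f ` Q \<subseteq> D"
  from assms obtain R where R: "continuous_on UNIV R" "range R \<subseteq> D" "\<And>x. x \<in> D \<Longrightarrow> R x = x"
    unfolding retract_of_def retraction_def by (auto simp: Pi_iff image_subset_iff)
  have "closedin (top_of_set S) Q" using Q by (simp add: closed_subset)
  then have "\<exists>h. continuous_on S h \<and> (\<forall>x\<in>Q. h x = f x v)" for v
    using Dugundji[of UNIV S Q "\<lambda>x. f x v"] f(1) continuous_on_product_then_coordinatewise
    by (metis UNIV_not_empty convex_UNIV subset_UNIV)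
  then obtain h where h: "\<And>v. continuous_on S (h v)" "\<And>v x. x \<in> Q \<Longrightarrow> h v x = f x v"
    by metis
  have "continuous_on S (\<lambda>x v. h v x)"
    using h(1) by (rule continuous_on_coordinatewise_then_product)
  then have "continuous_on S (\<lambda>x. R (\<lambda>v. h v x))"
    using continuous_on_compose2[OF R(1)] by blast
  moreover have "R (\<lambda>v. h v x) = f x" if "x \<in> Q" for x
    using h(2)[OF that] R(3)[of "f x"] f(2) that by auto
  ultimately show "\<exists>g. continuous_on S g \<and> g ` S \<subseteq> D \<and> (\<forall>x\<in>Q. g x = f x)"
    using R(2) by (intro exI[of _ "\<lambda>x. R (\<lambda>v. h v x)"]) auto
qed

text \<open>After an extension \<open>g\<close> into \<open>A \<union> B\<close>, the values on
  \<open>SB\<close> are replaced by an extension, into \<open>A \<inter> B\<close>, of the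
  restriction of \<open>g\<close> to \<open>SA \<inter> SB\<close>. Since \<open>f\<close> maps into
  \<open>A\<close>, the set \<open>Q\<close> lies in \<open>SA\<close>, where nothing
  changes.\<close>

lemma extensor_pushout:
  assumes "extensor n (A \<union> B)" "extensor n (A \<inter> B)" "closed A" "closed B"
  shows "extensor n A"
  unfolding extensor_def
proof (intro allI impI)
  fix S Q and f :: "(nat \<Rightarrow> real) \<Rightarrow> 'a"
  assume S: "thin n S" and Q: "closed Q" "Q \<subseteq> S" and f: "continuous_on Q f" "f ` Q \<subseteq> A"
  obtain g where g: "continuous_on S g" "g ` S \<subseteq> A \<union> B" "\<And>x. x \<in> Q \<Longrightarrow> g x = f x"
    using extensorE[OF assms(1) S Q f(1)] f(2) by auto
  define SA where "SA = S \<inter> g -` A"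
  define SB where "SB = S \<inter> g -` B"
  have cl: "closed SA" "closed SB"
    unfolding SA_def SB_def using g(1) thin_closed[OF S] assms(3,4) by (auto intro: continuous_closed_preimage)
  have "continuous_on (SA \<inter> SB) g" "g ` (SA \<inter> SB) \<subseteq> A \<inter> B"
    using g(1) by (auto simp: SA_def SB_def intro: continuous_on_subset)
  moreover have "thin n SB" using thin_subset[OF S cl(2)] by (auto simp: SB_def)
  ultimately obtain h where h: "continuous_on SB h" "h ` SB \<subseteq> A \<inter> B" "\<And>x. x \<in> SA \<inter> SB \<Longrightarrow> h x = g x"
    using extensorE[OF assms(2), of SB "SA \<inter> SB" g] cl by (metis closed_Int inf_le2)
  have "continuous_on (SA \<union> SB) (\<lambda>x. if x \<in> SA then g x else h x)"
    using cl h g(1) by (intro continuous_on_If) (auto simp: SA_def intro: continuous_on_subset)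
  moreover have "SA \<union> SB = S" using g(2) by (auto simp: SA_def SB_def)
  moreover have "(\<lambda>x. if x \<in> SA then g x else h x) ` S \<subseteq> A"
    using h(2) \<open>SA \<union> SB = S\<close> by (auto simp: SA_def)
  moreover have "x \<in> SA" "g x = f x" if "x \<in> Q" for x
    using that g(3)[OF that] f(2) Q(2) by (auto simp: SA_def)
  ultimately show "\<exists>g. continuous_on S g \<and> g ` S \<subseteq> A \<and> (\<forall>x\<in>Q. g x = f x)"
    by (intro exI[of _ "\<lambda>x. if x \<in> SA then g x else h x"]) auto
qed

subsection \<open>Independence complexes that are retracts of the ambient space\<close>

abbreviation geo :: "'a set \<Rightarrow> 'a set set \<Rightarrow> ('a \<Rightarrow> real) set" where
  "geo V C \<equiv> realization V (Ind V C)"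

text \<open>In this coordinate form \<open>C\<close> may be any family of nonfaces, singletons
  included, as the induction over suspensions requires.\<close>

lemma geo_iff:
  "x \<in> geo V C \<longleftrightarrow> (\<forall>v. 0 \<le> x v) \<and> (\<forall>v. v \<notin> V \<longrightarrow> x v = 0) \<and> sum x V = 1 \<and> (\<forall>E\<in>C. \<exists>v\<in>E. x v = 0)"
  unfolding realization_def Ind_def by (auto simp: subset_eq)

lemma geo_outside: "x \<in> geo V C \<Longrightarrow> v \<notin> V \<Longrightarrow> x v = 0"
  by (simp add: geo_iff)

lemma geo_zero: "x \<in> geo V C \<Longrightarrow> E \<in> C \<Longrightarrow> \<exists>v\<in>E. x v = 0"
  by (simp add: geo_iff)

lemma geo_insert: "x \<in> geo V (insert E C) \<longleftrightarrow> x \<in> geo V C \<and> (\<exists>v\<in>E. x v = 0)"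
  unfolding geo_iff by blast

lemma closed_geo:
  assumes "finite V" "C \<subseteq> Pow V"
  shows "closed (geo V C)"
proof -
  have coord: "continuous_on UNIV (\<lambda>x :: 'a \<Rightarrow> real. x v)" for v by simp
  \<comment> \<open>A vanishing product says that some vertex of a finite edge has coordinate 0, and
    is a closed condition.\<close>
  have "closed ((\<Inter>v. {x. 0 \<le> x v}) \<inter> (\<Inter>v\<in>-V. {x. x v = 0}) \<inter> {x. sum x V = 1}
        \<inter> (\<Inter>E\<in>C. {x :: 'a \<Rightarrow> real. (\<Prod>v\<in>E. x v) = 0}))"
    by (intro closed_Int closed_INT ballI closed_Collect_le closed_Collect_eq
        continuous_on_const continuous_on_sum continuous_on_prod coord)
  also have "(\<Inter>v. {x. 0 \<le> x v}) \<inter> (\<Inter>v\<in>-V. {x. x v = 0}) \<inter> {x. sum x V = 1}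
        \<inter> (\<Inter>E\<in>C. {x :: 'a \<Rightarrow> real. (\<Prod>v\<in>E. x v) = 0}) = geo V C"
  proof -
    have "(\<Prod>v\<in>E. x v) = 0 \<longleftrightarrow> (\<exists>v\<in>E. x v = 0)" if "E \<in> C" for E and x :: "'a \<Rightarrow> real"
      using assms that by (intro prod_zero_iff) (auto intro: finite_subset)
    then show ?thesis by (auto simp: geo_iff)
  qed
  finally show ?thesis .
qed

lemma continuous_on_Min_coordinates:
  fixes f :: "'i \<Rightarrow> 'b::topological_space \<Rightarrow> real"
  assumes "finite I" "I \<noteq> {}" "\<And>i. i \<in> I \<Longrightarrow> continuous_on S (f i)"
  shows "continuous_on S (\<lambda>x. Min ((\<lambda>i. f i x) ` I))"
  using assms by (induction rule: finite_ne_induct) (auto intro!: continuous_on_min)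

lemma simplex_retract:
  assumes "finite V" "V \<noteq> {}"
  shows "geo V {} retract_of (UNIV :: ('a \<Rightarrow> real) set)"
proof -
  define s where "s x = (\<Sum>v\<in>V. \<bar>x v\<bar>)" for x :: "'a \<Rightarrow> real"
  \<comment> \<open>After taking absolute values, a deficit of the total is spread evenly over
    \<open>V\<close>, and an excess is removed by scaling.\<close>
  define R where "R x v = (if v \<in> V then (\<bar>x v\<bar> + max 0 (1 - s x) / card V) / max 1 (s x) else 0)"
    for x :: "'a \<Rightarrow> real" and v
  have coord: "continuous_on UNIV (\<lambda>x :: 'a \<Rightarrow> real. x v)" for v by simp
  have s: "continuous_on UNIV s"
    unfolding s_def by (intro continuous_on_sum continuous_on_rabs coord)
  have "continuous_on UNIV (\<lambda>x. (\<bar>x v\<bar> + max 0 (1 - s x) / card V) / max 1 (s x))" for v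
    using assms by (intro continuous_on_divide continuous_on_add continuous_on_diff
        continuous_on_max continuous_on_rabs continuous_on_const coord s) (auto simp: max_def)
  then have "continuous_on UNIV (\<lambda>x. R x v)" for v
    unfolding R_def by (cases "v \<in> V") auto
  then have "continuous_on UNIV R"
    by (rule continuous_on_coordinatewise_then_product)
  moreover have "R x \<in> geo V {}" for x
  proof -
    have "sum (R x) V = (\<Sum>v\<in>V. (\<bar>x v\<bar> + max 0 (1 - s x) / card V) / max 1 (s x))"
      unfolding R_def by simp
    also have "\<dots> = (s x + max 0 (1 - s x)) / max 1 (s x)"
      unfolding sum_divide_distrib[symmetric] sum.distrib s_def using assms by simp
    also have "\<dots> = 1" by (auto simp: max_def)
    finally show ?thesis by (auto simp: geo_iff R_def)
  qed
  moreover have "R x = x" if x: "x \<in> geo V {}" for x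
  proof -
    have "s x = 1" using x by (auto simp: geo_iff s_def intro!: sum.cong)
    then show ?thesis using x by (auto simp: fun_eq_iff geo_iff R_def)
  qed
  ultimately show ?thesis
    unfolding retract_of_def retraction_def by blast
qed

text \<open>Moving the mass \<open>Min (x ` E)\<close> from each vertex of a non-face \<open>E\<close> to the apex \<open>u\<close>.\<close>

lemma cone_retraction:
  assumes "finite V" "u \<in> V" "finite C" "C \<subseteq> Pow (V - {u})" "{} \<notin> C"
  shows "\<exists>R. retraction (geo V {}) (geo V C) R \<and> (\<forall>x\<in>geo V {}. \<forall>w. w \<noteq> u \<longrightarrow> R x w \<le> x w)"
  using assms(3-5)
proof (induction C rule: finite_induct)
  case empty
  then show ?case
    by (intro exI[of _ id]) (auto simp: retraction_def)
next
  case (insert E C)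
  then obtain R where "retraction (geo V {}) (geo V C) R \<and> (\<forall>x\<in>geo V {}. \<forall>w. w \<noteq> u \<longrightarrow> R x w \<le> x w)"
    by auto
  then have R: "retraction (geo V {}) (geo V C) R"
      "\<And>x w. x \<in> geo V {} \<Longrightarrow> w \<noteq> u \<Longrightarrow> R x w \<le> x w" by blast+
  have E: "E \<subseteq> V" "u \<notin> E" "E \<noteq> {}" "finite E"
    using insert.prems assms(1) by (auto intro: finite_subset)
  define m where "m x = Min (x ` E)" for x :: "'a \<Rightarrow> real"
  define P where "P x w = x w - (if w \<in> E then m x else 0) + (if w = u then card E * m x else 0)"
    for x :: "'a \<Rightarrow> real" and w
  have coord: "continuous_on S (\<lambda>x :: 'a \<Rightarrow> real. x v)" for v S
    by (rule continuous_on_subset[of UNIV]) simp_all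
  have contm: "continuous_on S m" for S
    unfolding m_def using E by (intro continuous_on_Min_coordinates coord)
  have "continuous_on S (\<lambda>x. P x w)" for S w
    unfolding P_def
    by (cases "w \<in> E"; cases "w = u")
      (auto intro!: continuous_on_add continuous_on_diff continuous_on_mult continuous_on_const coord contm)
  then have contP: "continuous_on S P" for S
    by (rule continuous_on_coordinatewise_then_product)
  have m: "m x \<le> x w" if "w \<in> E" for x w
    using E that by (simp add: m_def)
  have m_att: "\<exists>w\<in>E. m x = x w" for x
  proof -
    have "m x \<in> x ` E" unfolding m_def using E by (intro Min_in) auto
    then show ?thesis by auto
  qed
  have P_geo: "P x \<in> geo V (insert E C)" if x: "x \<in> geo V C" for x
  proof -
    have m0: "m x \<ge> 0" using m_att[of x] x by (auto simp: geo_iff)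
    have "sum (P x) V = 1 - (\<Sum>w\<in>V. if w \<in> E then m x else 0) + (\<Sum>w\<in>V. if w = u then card E * m x else 0)"
      using x unfolding P_def by (simp add: sum.distrib sum_subtractf geo_iff)
    also have "(\<Sum>w\<in>V. if w \<in> E then m x else 0) = card E * m x"
      using assms(1) E(1) by (simp add: sum.If_cases inf.absorb_iff2 Int_commute)
    finally have "sum (P x) V = 1" using assms(1,2) by simp
    moreover have "0 \<le> P x w" for w using x m0 m[of w x] by (auto simp: P_def geo_iff)
    moreover have "\<exists>w\<in>E. P x w = 0" using m_att[of x] E by (auto simp: P_def)
    moreover have "\<exists>w\<in>E'. P x w = 0" if E': "E' \<in> C" for E'
    proof -
      obtain w where w: "w \<in> E'" "x w = 0" using geo_zero[OF x E'] by blast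
      \<comment> \<open>The apex, whose coordinate alone can grow, lies in no member of
        \<open>C\<close>. If \<open>w \<in> E\<close>, then \<open>m x = 0\<close> and nothing
        moves.\<close>
      moreover have "w \<noteq> u" using insert.prems E' w by auto
      ultimately have "P x w = 0"
        using m[of w x] m0 by (auto simp: P_def)
      with w show ?thesis by auto
    qed
    ultimately show ?thesis using x assms E by (auto simp: geo_iff P_def)
  qed
  have P_fix: "P x = x" if x: "x \<in> geo V (insert E C)" for x
  proof -
    obtain w where w: "w \<in> E" "x w = 0" using geo_zero x by (metis insertI1)
    have "m x = 0" using m[OF w(1), of x] w m_att[of x] x by (auto simp: geo_iff intro!: antisym)
    then show ?thesis by (auto simp: P_def)
  qed
  have sub: "geo V (insert E C) \<subseteq> geo V C" by (auto simp: geo_iff)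
  have "retraction (geo V C) (geo V (insert E C)) P"
    unfolding retraction_def using sub contP P_geo P_fix by auto
  then have "retraction (geo V {}) (geo V (insert E C)) (P \<circ> R)"
    using R(1) by (rule retraction_comp[rotated])
  \<comment> \<open>Carried through the induction so that a cap on a coordinate other than
    \<open>u\<close> survives the retraction.\<close>
  moreover have "(P \<circ> R) x w \<le> x w" if x: "x \<in> geo V {}" "w \<noteq> u" for x w
  proof -
    have "R x \<in> geo V C" using R(1) x by (auto simp: retraction_def)
    then have "m (R x) \<ge> 0" using m_att[of "R x"] by (auto simp: geo_iff)
    then have "P (R x) w \<le> R x w" using x by (auto simp: P_def)
    with R(2)[OF x] show ?thesis by simp
  qed
  ultimately show ?case by blast
qed

lemma cone_retract:
  assumes "finite V" "u \<in> V" "C \<subseteq> Pow (V - {u})" "{} \<notin> C"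
  shows "geo V C retract_of UNIV"
proof -
  have "finite C" using assms by (auto intro: finite_subset)
  then have "geo V C retract_of geo V {}"
    using cone_retraction[of V u C] assms by (auto simp: retract_of_def)
  also have "geo V {} retract_of (UNIV :: ('a \<Rightarrow> real) set)"
    using assms by (intro simplex_retract) auto
  finally show ?thesis .
qed

text \<open>The excess of the coordinate at \<open>v\<close> over \<open>c\<close> moves to
  \<open>u\<close>.\<close>

lemma capped_simplex_retract:
  assumes "finite V" "u \<in> V" "v \<noteq> u" "c \<ge> 0"
  shows "{x \<in> geo V {}. x v \<le> c} retract_of geo V {}"
proof -
  define R where "R x w = x w - (if w = v then max 0 (x v - c) else 0)
    + (if w = u then max 0 (x v - c) else 0)" for x :: "'a \<Rightarrow> real" and w
  have coord: "continuous_on S (\<lambda>x :: 'a \<Rightarrow> real. x v)" for v S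
    by (rule continuous_on_subset[of UNIV]) simp_all
  have "continuous_on S (\<lambda>x. R x w)" for S w
    unfolding R_def
    by (cases "w = v"; cases "w = u")
      (auto intro!: continuous_on_add continuous_on_diff continuous_on_max continuous_on_const coord)
  then have "continuous_on S R" for S
    by (rule continuous_on_coordinatewise_then_product)
  moreover have "R x \<in> {x \<in> geo V {}. x v \<le> c}" if x: "x \<in> geo V {}" for x
  proof (cases "v \<in> V")
    case True
    then have "sum (R x) V = 1"
      using x assms unfolding R_def by (simp add: sum.distrib sum_subtractf geo_iff)
    then show ?thesis using x assms True by (auto simp: geo_iff R_def max_def)
  next
    case False
    then have "x v = 0" using x by (simp add: geo_iff)
    then have "R x = x" using assms by (auto simp: R_def fun_eq_iff)
    then show ?thesis using x \<open>x v = 0\<close> assms by auto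
  qed
  moreover have "R x = x" if "x v \<le> c" for x
    using that by (auto simp: R_def fun_eq_iff)
  ultimately show ?thesis
    unfolding retract_of_def retraction_def by (intro exI[of _ R]) auto
qed

text \<open>The simplex on \<open>H\<close> is punctured at a point \<open>b\<close> close to \<open>v\<close>, where the coordinate at \<open>v\<close>
  exceeds the cap, and then projected radially from \<open>b\<close>.\<close>

lemma capped_puncture_retract:
  assumes V: "finite V" and H: "H \<subseteq> V" "v \<in> H" "H - {v} \<noteq> {}" and C: "\<And>E. E \<in> C \<Longrightarrow> E \<inter> H = {}"
  shows "{x \<in> geo V (insert H C). x v \<le> 2/3} retract_of {x \<in> geo V C. x v \<le> 2/3}"
proof -
  have fH: "finite H" using V H(1) by (rule finite_subset[rotated])
  \<comment> \<open>A point inside the simplex on \<open>H\<close>: its coordinates on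
    \<open>H\<close> are positive with sum 1, and \<open>5/6\<close> at \<open>v\<close> exceeds the
    cap \<open>2/3\<close>.\<close>
  define b where "b w = (if w = v then 5/6 else 1 / (6 * real (card (H - {v}))))" for w
  have "card (H - {v}) > 0" using fH H(3) by (simp add: card_gt_0_iff)
  then have bpos: "b w > 0" for w by (simp add: b_def)
  have "sum b H = b v + sum b (H - {v})"
    using fH H(2) by (simp add: sum.remove)
  also have "sum b (H - {v}) = (\<Sum>w\<in>H - {v}. 1 / (6 * real (card (H - {v}))))"
    by (intro sum.cong) (auto simp: b_def)
  also have "\<dots> = 1/6" using fH H(3) by simp
  finally have sumb: "sum b H = 1" by (simp add: b_def)
  \<comment> \<open>The largest factor with which \<open>b\<close> can be subtracted on
    \<open>H\<close> without creating a negative coordinate there; dividing by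
    \<open>1 - m x\<close> then restores the total.\<close>
  define m where "m x = Min ((\<lambda>w. x w / b w) ` H)" for x :: "'a \<Rightarrow> real"
  define R where "R x w = (x w - (if w \<in> H then m x * b w else 0)) / (1 - m x)"
    for x :: "'a \<Rightarrow> real" and w
  define T where "T = {x \<in> geo V C. x v \<le> 2/3}"
  have coord: "continuous_on S (\<lambda>x :: 'a \<Rightarrow> real. x v)" for v S
    by (rule continuous_on_subset[of UNIV]) simp_all
  have contm: "continuous_on S m" for S
    unfolding m_def using fH H bpos
    by (intro continuous_on_Min_coordinates continuous_on_divide coord continuous_on_const) (auto simp: less_le)
  have m_le: "m x * b w \<le> x w" if "w \<in> H" for x w
  proof -
    have "m x \<le> x w / b w" using fH that by (auto simp: m_def)
    then show ?thesis using bpos[of w] by (simp add: field_simps)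
  qed
  have m_att: "\<exists>w\<in>H. m x * b w = x w" for x
  proof -
    have "m x \<in> (\<lambda>w. x w / b w) ` H" unfolding m_def using fH H by (intro Min_in) auto
    then obtain w where "w \<in> H" "m x = x w / b w" by auto
    then show ?thesis using bpos[of w] by (intro bexI[of _ w]) auto
  qed
  \<comment> \<open>The cap enters here: \<open>m x * 5/6 \<le> x v \<le> 2/3\<close> gives
    \<open>m x \<le> 4/5\<close>.\<close>
  have m_lt: "m x < 1" if "x \<in> T" for x
    using m_le[OF H(2), of x] that by (auto simp: T_def b_def)
  have m_ge: "m x \<ge> 0" if x: "x \<in> T" for x
  proof -
    obtain w where w: "w \<in> H" "m x * b w = x w" using m_att by blast
    then have "0 \<le> m x * b w" using x by (auto simp: T_def geo_iff)
    then show ?thesis using bpos[of w] by (simp add: zero_le_mult_iff)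
  qed
  have "continuous_on T (\<lambda>x. R x w)" for w
    unfolding R_def using m_lt
    by (cases "w \<in> H")
      (fastforce intro!: continuous_on_divide continuous_on_diff continuous_on_mult continuous_on_const coord contm)+
  then have "continuous_on T R"
    by (rule continuous_on_coordinatewise_then_product)
  moreover have "R x \<in> {x \<in> geo V (insert H C). x v \<le> 2/3}" if x: "x \<in> T" for x
  proof -
    have xg: "x \<in> geo V C" "x v \<le> 2/3" using x by (auto simp: T_def)
    have "sum (R x) V = (sum x V - (\<Sum>w\<in>V. if w \<in> H then m x * b w else 0)) / (1 - m x)"
      unfolding R_def by (simp add: sum_divide_distrib[symmetric] sum_subtractf)
    also have "(\<Sum>w\<in>V. if w \<in> H then m x * b w else 0) = (\<Sum>w\<in>H. m x * b w)"
      using V H(1) by (simp add: sum.If_cases inf.absorb_iff2 Int_commute)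
    also have "\<dots> = m x" using sumb by (simp add: sum_distrib_left[symmetric])
    finally have "sum (R x) V = 1" using xg m_lt[OF x] by (simp add: geo_iff)
    moreover have "0 \<le> R x w" for w
      using m_lt[OF x] m_le[of w x] xg by (auto simp: R_def geo_iff)
    moreover have "R x w = 0" if "w \<notin> V" for w
      using that xg H(1) by (auto simp: R_def geo_iff)
    moreover have "\<exists>w\<in>H. R x w = 0" using m_att[of x] by (force simp: R_def)
    moreover have "\<exists>w\<in>E. R x w = 0" if E: "E \<in> C" for E
    proof -
      obtain w where "w \<in> E" "x w = 0" using geo_zero[OF xg(1) E] by blast
      moreover have "w \<notin> H" using C[OF E] calculation by auto
      ultimately show ?thesis by (auto simp: R_def intro!: bexI[of _ w])
    qed
    \<comment> \<open>Subtracting \<open>5/6 * m x\<close> from a number at most \<open>2/3\<close>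
      leaves at most \<open>2/3 * (1 - m x)\<close>.\<close>
    moreover have "R x v \<le> 2/3"
      using m_lt[OF x] m_ge[OF x] xg H(2) by (simp add: R_def b_def divide_le_eq)
    ultimately show ?thesis by (auto simp: geo_iff)
  qed
  moreover have "R x = x" if x: "x \<in> geo V (insert H C)" "x \<in> T" for x
  proof -
    obtain w where w: "w \<in> H" "x w = 0" using geo_zero x by (metis insertI1)
    have "m x = 0" using m_le[OF w(1), of x] w bpos[of w] m_ge[OF x(2)]
      by (simp add: mult_le_0_iff)
    then show ?thesis by (auto simp: R_def)
  qed
  moreover have "{x \<in> geo V (insert H C). x v \<le> 2/3} \<subseteq> T"
    by (auto simp: T_def geo_iff)
  ultimately show ?thesis
    unfolding retract_of_def retraction_def T_def[symmetric] by (intro exI[of _ R]) auto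
qed

text \<open>A chain of retracts: the simplex, the capped simplex, the capped realization for
  \<open>C\<close>, and finally the punctured one. A vertex \<open>u\<close> of \<open>H\<close>
  other than \<open>v\<close> lies in no member of \<open>C\<close>, so it can receive the mass in
  the two middle stages.\<close>

lemma capped_retract:
  assumes V: "finite V" and H: "H \<subseteq> V" "v \<in> H" "H - {v} \<noteq> {}" and C: "\<And>E. E \<in> C \<Longrightarrow> E \<inter> H = {}"
    "C \<subseteq> Pow V" "{} \<notin> C"
  shows "{x \<in> geo V (insert H C). x v \<le> 2/3} retract_of UNIV"
proof -
  obtain u where u: "u \<in> H" "u \<noteq> v" using H by auto
  have "{x \<in> geo V (insert H C). x v \<le> 2/3} retract_of {x \<in> geo V C. x v \<le> 2/3}"
    using V H C(1) by (rule capped_puncture_retract)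
  also have "{x \<in> geo V C. x v \<le> 2/3} retract_of {x \<in> geo V {}. x v \<le> 2/3}"
  proof -
    have "finite C" using V C(2) by (auto intro: finite_subset)
    moreover have "C \<subseteq> Pow (V - {u})" using C u by blast
    ultimately obtain R where R: "retraction (geo V {}) (geo V C) R"
        "\<And>x w. x \<in> geo V {} \<Longrightarrow> w \<noteq> u \<Longrightarrow> R x w \<le> x w"
      using cone_retraction[of V u C] V H(1) u C(3) by blast
    have "retraction {x \<in> geo V {}. x v \<le> 2/3} {x \<in> geo V C. x v \<le> 2/3} R"
      unfolding retraction_def
    proof (intro conjI Pi_I ballI)
      fix x assume x: "x \<in> {x \<in> geo V {}. x v \<le> 2/3}"
      then have "R x v \<le> x v" using R(2)[of x v] u by auto
      then show "R x \<in> {x \<in> geo V C. x v \<le> 2/3}" using R(1) x by (auto simp: retraction_def)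
    qed (use R(1) in \<open>auto simp: retraction_def intro: continuous_on_subset\<close>)
    then show ?thesis by (auto simp: retract_of_def)
  qed
  also have "{x \<in> geo V {}. x v \<le> 2/3} retract_of geo V {}"
    using V H u by (intro capped_simplex_retract[of V u]) auto
  also have "geo V {} retract_of (UNIV :: ('a \<Rightarrow> real) set)"
    using V H by (intro simplex_retract) auto
  finally show ?thesis .
qed

subsection \<open>Suspensions and joins\<close>

lemma real_extension:
  fixes f :: "'b::{metric_space,second_countable_topology} \<Rightarrow> real"
  assumes "closed Q" "Q \<subseteq> S" "continuous_on Q f" "f ` Q \<subseteq> {a..b}" "a \<le> b"
  obtains g where "continuous_on S g" "g ` S \<subseteq> {a..b}" "\<And>x. x \<in> Q \<Longrightarrow> g x = f x"
  using Dugundji[of "{a..b}" S Q f] assms by (auto simp: closed_subset)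

text \<open>The levels \<open>1/3\<close> and \<open>2/3\<close> of the coordinate at \<open>v\<close> leave a collar around the base
  \<open>geo (V \<union> G) (insert G C)\<close> of the cone with apex \<open>v\<close>.  The map is first extended over a partition
  \<open>W\<close> between these levels, where it lies in the collar and only the base matters, and then over
  both sides of \<open>W\<close>, whose targets are retracts of the ambient space.\<close>

lemma extensor_suspension:
  fixes V :: "'a set"
  assumes fin: "finite V" "finite G" and C: "C \<subseteq> Pow V" "{} \<notin> C"
    and G: "G \<noteq> {}" "G \<inter> V = {}" and v: "v \<notin> V \<union> G"
    and ext: "extensor n (geo (V \<union> G) (insert G C))"
  shows "extensor (Suc n) (geo (insert v (V \<union> G)) (insert (insert v G) C))" (is "extensor _ ?Z")
  unfolding extensor_def
proof (intro allI impI)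
  fix S Q and f :: "(nat \<Rightarrow> real) \<Rightarrow> 'a \<Rightarrow> real"
  assume S: "thin (Suc n) S" and Q: "closed Q" "Q \<subseteq> S" and f: "continuous_on Q f" "f ` Q \<subseteq> ?Z"
  let ?V = "insert v (V \<union> G)"
  let ?D = "geo (V \<union> G) (insert G C)"
  \<comment> \<open>\<open>?A\<close> is the cone with apex \<open>v\<close> over \<open>?D\<close>.
    \<open>?B\<close> consists of the other cone of the suspension, the points with coordinate 0 at
    \<open>v\<close>, and the part of \<open>?A\<close> up to level \<open>2/3\<close>.\<close>
  let ?A = "geo ?V (insert G C)"
  let ?B = "{x \<in> ?Z. x v \<le> 2/3}"
  have AZ: "?A \<subseteq> ?Z" by (auto simp: geo_iff)
  have A_ext: "extensor k ?A" for k
    using fin C G v by (intro extensor_retract cone_retract[of _ v]) auto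
  have B_ext: "extensor k ?B" for k
    using fin C G v by (intro extensor_retract capped_retract) auto
  have in_A: "x \<in> ?A" if x: "x \<in> ?Z" "x v > 0" for x
    using x by (auto simp: geo_iff)
  have fv: "continuous_on Q (\<lambda>x. f x v)"
    using f(1) by (rule continuous_on_product_then_coordinatewise)
  define X where "X = {x \<in> Q. f x v \<ge> 2/3}"
  define Y where "Y = {x \<in> Q. f x v \<le> 1/3}"
  have "closed X" "closed Y"
    using continuous_closed_preimage[OF fv Q(1), of "{2/3..}"] continuous_closed_preimage[OF fv Q(1), of "{..1/3}"]
    by (simp_all add: X_def Y_def vimage_def Int_def)
  moreover have "X \<inter> Y = {}" "X \<subseteq> S" "Y \<subseteq> S" using Q(2) by (auto simp: X_def Y_def)
  ultimately obtain PA PB where P: "closed PA" "closed PB" "PA \<union> PB = S" "PA \<inter> Y = {}" "PB \<inter> X = {}"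
      "thin n (PA \<inter> PB)"
    using thin_separation[OF S] by metis
  define W where "W = PA \<inter> PB"
  have clW: "closed W" using P by (auto simp: W_def)
  \<comment> \<open>Hence \<open>f\<close> sends the points of \<open>Q\<close> in \<open>PA\<close>
    into \<open>?A\<close> and those in \<open>PB\<close> into \<open>?B\<close>.\<close>
  have lev: "x \<in> Q \<Longrightarrow> x \<in> PA \<Longrightarrow> f x v > 1/3" "x \<in> Q \<Longrightarrow> x \<in> PB \<Longrightarrow> f x v < 2/3" for x
    using P(4,5) by (auto simp: X_def Y_def not_le[symmetric])
  \<comment> \<open>Radial projection from the apex \<open>v\<close> to the base
    \<open>?D\<close>.\<close>
  define p where "p x w = (if w = v then 0 else f x w / (1 - f x v))" for x w
  have QW: "Q \<inter> W \<subseteq> Q" by auto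
  have levW: "1/3 < f x v" "f x v < 2/3" if "x \<in> Q \<inter> W" for x
    using lev[of x] that by (auto simp: W_def)
  have "continuous_on (Q \<inter> W) (\<lambda>x. f x w)" for w
    using f(1) QW by (metis continuous_on_product_then_coordinatewise continuous_on_subset)
  then have "continuous_on (Q \<inter> W) (\<lambda>x. p x w)" for w
    unfolding p_def using levW
    by (cases "w = v") (fastforce intro!: continuous_on_divide continuous_on_diff continuous_on_const)+
  then have cp: "continuous_on (Q \<inter> W) p"
    by (rule continuous_on_coordinatewise_then_product)
  have p_D: "p x \<in> ?D" if x: "x \<in> Q \<inter> W" for x
  proof -
    have fx: "f x \<in> ?A" using in_A[of "f x"] levW[OF x] f(2) x by auto
    have "sum (p x) (V \<union> G) = sum (f x) (V \<union> G) / (1 - f x v)"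
      unfolding sum_divide_distrib using v by (intro sum.cong) (auto simp: p_def)
    moreover have "sum (f x) (V \<union> G) = 1 - f x v"
      using fx v fin by (simp add: geo_iff)
    ultimately have "sum (p x) (V \<union> G) = 1" using levW[OF x] by simp
    moreover have "\<exists>w\<in>E. p x w = 0" if "E \<in> insert G C" for E
      using geo_zero[OF fx that] by (auto simp: p_def)
    ultimately show ?thesis using fx levW[OF x] by (auto simp: geo_iff p_def)
  qed
  obtain h where h: "continuous_on W h" "h ` W \<subseteq> ?D" "\<And>x. x \<in> Q \<inter> W \<Longrightarrow> h x = p x"
  proof (rule extensorE[OF ext P(6)])
    show "closed (Q \<inter> W)" "Q \<inter> W \<subseteq> PA \<inter> PB" "p ` (Q \<inter> W) \<subseteq> ?D"
      using Q(1) clW p_D by (auto simp: W_def)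
  qed (use cp that in \<open>auto simp: W_def\<close>)
  obtain t where t: "continuous_on W t" "t ` W \<subseteq> {1/3..2/3}" "\<And>x. x \<in> Q \<inter> W \<Longrightarrow> t x = f x v"
  proof (rule real_extension[of "Q \<inter> W" W "\<lambda>x. f x v" "1/3" "2/3"])
    show "(\<lambda>x. f x v) ` (Q \<inter> W) \<subseteq> {1/3..2/3}" using levW by (fastforce intro: less_imp_le)
    show "continuous_on (Q \<inter> W) (\<lambda>x. f x v)" using fv QW by (rule continuous_on_subset)
  qed (use Q(1) clW that in auto)
  \<comment> \<open>On \<open>W\<close> outside \<open>Q\<close> this is the point of the cone at
    height \<open>t x\<close> over \<open>h x\<close>; on \<open>Q \<inter> W\<close> the same
    formula returns \<open>f x\<close>. As \<open>t x \<le> 2/3\<close>, all of \<open>W\<close>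
    goes into both targets.\<close>
  define F where "F x = (if x \<in> Q then f x else (\<lambda>w. (1 - t x) * h x w + (if w = v then t x else 0)))" for x
  have cone_eq: "(\<lambda>w. (1 - t x) * h x w + (if w = v then t x else 0)) = f x" if x: "x \<in> Q \<inter> W" for x
    using h(3)[OF x] t(3)[OF x] levW[OF x] by (auto simp: fun_eq_iff p_def)
  have "continuous_on W (\<lambda>x w. (1 - t x) * h x w + (if w = v then t x else 0))"
  proof (rule continuous_on_coordinatewise_then_product)
    fix w
    have "continuous_on W (\<lambda>x. h x w)" using h(1) by (rule continuous_on_product_then_coordinatewise)
    then show "continuous_on W (\<lambda>x. (1 - t x) * h x w + (if w = v then t x else 0))"
      using t(1) by (cases "w = v") (auto intro!: continuous_on_add continuous_on_mult continuous_on_diff continuous_on_const)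
  qed
  then have cF: "continuous_on (Q \<union> W) F"
    unfolding F_def using Q(1) clW f(1) cone_eq by (intro continuous_on_If) auto
  have F_W: "F x \<in> ?A" "F x v \<le> 2/3" if x: "x \<in> W" for x
  proof -
    have hx: "h x \<in> ?D" and tx: "1/3 \<le> t x" "t x \<le> 2/3" using h(2) t(2) x by auto
    have Fx: "F x = (\<lambda>w. (1 - t x) * h x w + (if w = v then t x else 0))"
      using cone_eq x by (auto simp: F_def)
    have hv: "h x v = 0" using hx v by (simp add: geo_iff)
    then show "F x v \<le> 2/3" using tx by (simp add: Fx)
    have "sum (F x) (V \<union> G) = (\<Sum>w\<in>V \<union> G. (1 - t x) * h x w)"
      using v by (intro sum.cong) (auto simp: Fx)
    also have "\<dots> = 1 - t x" using hx by (simp add: sum_distrib_left[symmetric] geo_iff)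
    finally have "sum (F x) ?V = 1" using v fin hv by (simp add: Fx)
    moreover have "\<exists>w\<in>E. F x w = 0" if E: "E \<in> insert G C" for E
    proof -
      obtain w where w: "w \<in> E" "h x w = 0" using geo_zero[OF hx E] by blast
      moreover have "w \<noteq> v" using w E C v by auto
      ultimately show ?thesis by (auto simp: Fx)
    qed
    ultimately show "F x \<in> ?A" using hx tx by (auto simp: geo_iff Fx)
  qed
  have fA: "f x \<in> ?A" if "x \<in> Q" "x \<in> PA" for x
    using in_A[of "f x"] lev(1)[OF that] f(2) that by auto
  have thin_P: "thin (Suc n) PA" "thin (Suc n) PB"
    using thin_subset[OF S] P by auto
  obtain gA where gA: "continuous_on PA gA" "gA ` PA \<subseteq> ?A" "\<And>x. x \<in> (Q \<union> W) \<inter> PA \<Longrightarrow> gA x = F x"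
  proof (rule extensorE[OF A_ext thin_P(1)])
    show "closed ((Q \<union> W) \<inter> PA)" using Q(1) clW P(1) by auto
    show "continuous_on ((Q \<union> W) \<inter> PA) F" using cF by (rule continuous_on_subset) auto
    show "F ` ((Q \<union> W) \<inter> PA) \<subseteq> ?A"
    proof (intro image_subsetI)
      fix x assume "x \<in> (Q \<union> W) \<inter> PA"
      then show "F x \<in> ?A" using F_W(1)[of x] fA[of x] by (cases "x \<in> Q") (auto simp: F_def)
    qed
  qed (use that in auto)
  obtain gB where gB: "continuous_on PB gB" "gB ` PB \<subseteq> ?B" "\<And>x. x \<in> (Q \<union> W) \<inter> PB \<Longrightarrow> gB x = F x"
  proof (rule extensorE[OF B_ext thin_P(2)])
    show "closed ((Q \<union> W) \<inter> PB)" using Q(1) clW P(2) by auto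
    show "continuous_on ((Q \<union> W) \<inter> PB) F" using cF by (rule continuous_on_subset) auto
    have "F x \<in> ?B" if "x \<in> Q" "x \<in> PB" for x
      using lev(2)[OF that] f(2) that by (auto simp: F_def)
    moreover have "F x \<in> ?B" if "x \<in> W" for x
      using F_W[OF that] AZ by auto
    ultimately show "F ` ((Q \<union> W) \<inter> PB) \<subseteq> ?B" by blast
  qed (use that in auto)
  \<comment> \<open>Both maps extend \<open>F\<close>, so they agree on \<open>W\<close>.\<close>
  define g where "g x = (if x \<in> PA then gA x else gB x)" for x
  have "continuous_on (PA \<union> PB) g"
    unfolding g_def using P(1,2) gA gB by (intro continuous_on_If) (auto simp: W_def)
  moreover have "g ` S \<subseteq> ?Z"
  proof (intro image_subsetI)
    fix x assume "x \<in> S"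
    then consider "x \<in> PA" | "x \<notin> PA" "x \<in> PB" using P(3) by auto
    then show "g x \<in> ?Z"
    proof cases
      case 1
      then show ?thesis using gA(2) AZ by (auto simp: g_def)
    next
      case 2
      then show ?thesis using gB(2) by (auto simp: g_def)
    qed
  qed
  moreover have "g x = f x" if "x \<in> Q" for x
    using that gA(3)[of x] gB(3)[of x] P(3) Q(2) by (auto simp: g_def F_def)
  ultimately show "\<exists>g. continuous_on S g \<and> g ` S \<subseteq> ?Z \<and> (\<forall>x\<in>Q. g x = f x)"
    using P(3) by auto
qed

lemma geo_singleton_nonface:
  assumes "finite V" "u \<notin> V"
  shows "geo (insert u V) (insert {u} C) = geo V C"
  using assms by (auto simp: geo_iff)

text \<open>For a single vertex the boundary is the complex with only the empty face, and the join
  is \<open>geo V C\<close> itself. Each further vertex of \<open>F\<close> suspends once more,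
  hence \<open>card F - 1\<close>.\<close>

lemma extensor_join_boundary:
  fixes V :: "'a set"
  assumes "finite F" "F \<noteq> {}" "finite V" "C \<subseteq> Pow V" "{} \<notin> C" "F \<inter> V = {}" "extensor n (geo V C)"
  shows "extensor (n + (card F - 1)) (geo (V \<union> F) (insert F C))"
  using assms
proof (induction F rule: finite_ne_induct)
  case (singleton u)
  then show ?case by (simp add: geo_singleton_nonface)
next
  case (insert v F)
  then have "extensor (n + (card F - 1)) (geo (V \<union> F) (insert F C))" by auto
  then have "extensor (Suc (n + (card F - 1))) (geo (insert v (V \<union> F)) (insert (insert v F) C))"
    using insert by (intro extensor_suspension) auto
  moreover have "Suc (n + (card F - 1)) = n + (card (insert v F) - 1)"
    using insert.hyps by (simp add: card_gt_0_iff)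
  ultimately show ?case by (metis Un_insert_right)
qed

subsection \<open>Deletion of an edge\<close>

text \<open>A vertex of \<open>nbhd C F\<close> forms a singleton \<open>E' - F\<close>; a minimal
  member containing that vertex would equal it and have cardinality 1.\<close>

lemma colon_hypergraph:
  assumes "hypergraph V C" "F \<in> C"
  shows "hypergraph (V - (F \<union> nbhd C F)) (colon C F)"
proof -
  have "G \<subseteq> V - (F \<union> nbhd C F)" if G: "G \<in> colon C F" for G
  proof
    fix w assume w: "w \<in> G"
    have min: "\<And>E'. E' \<in> C - {F} \<Longrightarrow> E' - F \<subseteq> G \<Longrightarrow> E' - F = G" and c: "2 \<le> card G"
      using G by (auto simp: colon_def Let_def)
    obtain E where E: "E \<in> C" "G = E - F" using G by (auto simp: colon_def Let_def)
    have "w \<notin> nbhd C F"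
    proof
      assume "w \<in> nbhd C F"
      then obtain E' where E': "E' \<in> C" "card (E' - F) = 1" "w \<in> E' - F" by (auto simp: nbhd_def)
      then have "E' - F = {w}" by (metis card_1_singletonE singletonD)
      then have "E' - F = G" using min[of E'] E'(1) w by auto
      then show False using E'(2) c by simp
    qed
    then show "w \<in> V - (F \<union> nbhd C F)" using E w assms by (auto simp: hypergraph_def)
  qed
  then show ?thesis
    using assms by (auto simp: hypergraph_def colon_def Let_def)
qed

text \<open>An application of \<open>extensor_pushout\<close> in which \<open>?B\<close> is the star
  of \<open>F\<close>; adding \<open>F\<close> as a nonface cuts \<open>?B\<close> down to the join
  with the boundary of \<open>F\<close>.\<close>

lemma extensor_deletion:
  fixes V :: "'a set"
  assumes hyp: "hypergraph V C" and F: "F \<in> C"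
    and del: "extensor n (geo V (C - {F}))"
    and col: "extensor n (geo ((V - (F \<union> nbhd C F)) \<union> F) (insert F (colon C F)))"
  shows "extensor n (geo V C)"
proof -
  let ?L = "V - (F \<union> nbhd C F)"
  let ?B = "geo (?L \<union> F) (colon C F)"
  have V: "finite V" "F \<subseteq> V" "C \<subseteq> Pow V" using hyp F by (auto simp: hypergraph_def)
  have anti: "E \<in> C \<Longrightarrow> E \<subseteq> F \<Longrightarrow> E = F" for E using hyp F by (auto simp: hypergraph_def)
  have colC: "colon C F \<subseteq> Pow ?L" using colon_hypergraph[OF hyp F] by (auto simp: hypergraph_def)
  have sumL: "sum x (?L \<union> F) = sum x V" if "\<And>w. w \<notin> ?L \<union> F \<Longrightarrow> x w = 0" for x :: "'a \<Rightarrow> real"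
    using V that by (intro sum.mono_neutral_left) auto
  \<comment> \<open>Outside \<open>geo V C\<close> all of \<open>F\<close> lies in the support, so
    on every other edge \<open>x\<close> vanishes at a vertex outside \<open>F\<close>; singletons
    \<open>E - F\<close> thus force \<open>x\<close> to vanish on \<open>nbhd C F\<close>.\<close>
  have star: "x \<in> ?B" if x: "x \<in> geo V (C - {F})" "x \<notin> geo V C" for x
  proof -
    have Fx: "x w \<noteq> 0" if "w \<in> F" for w
      using x that by (auto simp: geo_iff)
    have zero: "\<exists>w\<in>E - F. x w = 0" if "E \<in> C - {F}" for E
      using geo_zero[OF x(1) that] Fx by auto
    have out: "x w = 0" if "w \<notin> ?L \<union> F" for w
    proof (cases "w \<in> nbhd C F")
      case True
      then obtain E where E: "E \<in> C" "card (E - F) = 1" "w \<in> E - F" by (auto simp: nbhd_def)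
      then have "E - F = {w}" by (metis card_1_singletonE singletonD)
      then show ?thesis using zero[of E] E(1) by auto
    next
      case False
      then show ?thesis using that x(1) by (auto simp: geo_iff)
    qed
    have "\<exists>w\<in>G. x w = 0" if G: "G \<in> colon C F" for G
    proof -
      obtain E where "E \<in> C - {F}" "G = E - F" using G by (auto simp: colon_def Let_def)
      then show ?thesis using zero by blast
    qed
    moreover have "sum x (?L \<union> F) = sum x V" by (rule sumL) (rule out)
    ultimately show ?thesis using x(1) out unfolding geo_iff by auto
  qed
  have join: "x \<in> geo V (C - {F})" if x: "x \<in> ?B" for x
  proof -
    have out: "x w = 0" if "w \<notin> ?L \<union> F" for w by (rule geo_outside[OF x that])
    have "\<exists>w\<in>E. x w = 0" if E: "E \<in> C - {F}" for E
    proof -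
      \<comment> \<open>\<open>E - F\<close> contains a minimal member \<open>G\<close> of
        \<open>D\<close>, nonempty because edges are incomparable. A singleton \<open>G\<close> lies
        in \<open>nbhd C F\<close>, where \<open>x\<close> vanishes; any other is an edge of
        \<open>colon C F\<close>.\<close>
      define D where "D = {E - F | E. E \<in> C - {F}}"
      have "D \<subseteq> Pow V" using V by (auto simp: D_def)
      then have "finite D" using V(1) by (auto intro: finite_subset)
      moreover have "E - F \<in> D" using E by (auto simp: D_def)
      ultimately obtain G where G: "G \<in> D" "G \<subseteq> E - F" "\<And>G'. G' \<in> D \<Longrightarrow> G' \<subseteq> G \<Longrightarrow> G' = G"
        using finite_has_minimal2[of D "E - F"] by metis
      obtain E' where E': "E' \<in> C" "E' \<noteq> F" "G = E' - F" using G(1) by (auto simp: D_def)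
      have "finite G" using \<open>D \<subseteq> Pow V\<close> G(1) V(1) by (auto intro: finite_subset)
      moreover have "G \<noteq> {}" using anti[of E'] E' by auto
      ultimately have "card G \<noteq> 0" by simp
      then consider "card G = 1" | "2 \<le> card G" by linarith
      then show ?thesis
      proof cases
        case 1
        then obtain w where w: "G = {w}" by (metis card_1_singletonE)
        have "E' - F \<subseteq> nbhd C F"
          unfolding nbhd_def using E' 1 by (intro Union_upper) auto
        then have "w \<in> nbhd C F" using w E'(3) by auto
        then have "x w = 0" using out[of w] w E'(3) by auto
        then show ?thesis using w G(2) by auto
      next
        case 2
        then have "G \<in> colon C F" using G(1,3) unfolding colon_def Let_def D_def[symmetric] by simp
        then show ?thesis using geo_zero[OF x, of G] G(2) by auto
      qed
    qed
    moreover have "sum x (?L \<union> F) = sum x V" by (rule sumL) (rule out)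
    ultimately show ?thesis using x V(2) unfolding geo_iff by auto
  qed
  have geo_C: "x \<in> geo V C \<longleftrightarrow> x \<in> geo V (C - {F}) \<and> (\<exists>w\<in>F. x w = 0)" for x
    using geo_insert[of x V F "C - {F}"] F by (simp only: insert_Diff)
  have "geo V C \<union> ?B = geo V (C - {F})"
    using star join geo_C by blast
  moreover have "geo V C \<inter> ?B = geo (?L \<union> F) (insert F (colon C F))"
    using join geo_C geo_insert[of _ "?L \<union> F" F "colon C F"] by blast
  moreover have "closed (geo V C)" "closed ?B"
    using V colC finite_subset[of F V] by (auto intro!: closed_geo)
  ultimately show ?thesis
    using extensor_pushout[of n "geo V C" ?B] del col by simp
qed

text \<open>With the fuel exhausted or \<open>V\<close> empty, only the trivial case
  \<open>k = 0\<close> remains. Otherwise the maximum is attained at an edge \<open>F\<close>, and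
  the two entries of its minimum supply the two premises of
  \<open>extensor_deletion\<close>.\<close>

lemma extensor_psi_aux:
  assumes "hypergraph V C" "enat k \<le> psi_aux n V C"
  shows "extensor k (geo V C)"
  using assms
proof (induction n arbitrary: k V C)
  case 0
  then show ?case by (simp add: extensor_0 zero_enat_def)
next
  case (Suc n)
  have V: "finite V" "C \<subseteq> Pow V" using Suc.prems by (auto simp: hypergraph_def)
  consider "V = {}" | "V \<noteq> {}" "C = {}" | "V \<noteq> {}" "C \<noteq> {}" by blast
  then show ?case
  proof cases
    case 1
    then show ?thesis using Suc.prems by (simp add: extensor_0 zero_enat_def)
  next
    case 2
    then show ?thesis using V by (auto intro: extensor_retract simplex_retract)
  next
    case 3
    let ?L = "\<lambda>F. V - (F \<union> nbhd C F)"
    let ?\<psi> = "\<lambda>F. min (psi_aux n V (C - {F})) (psi_aux n (?L F) (colon C F) + enat (card F - 1))"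
    have "finite C" using V by (auto intro: finite_subset)
    then have "Max (?\<psi> ` C) \<in> ?\<psi> ` C" using 3 by (intro Max_in) auto
    then obtain F where F: "F \<in> C" "Max (?\<psi> ` C) = ?\<psi> F" by blast
    have le: "enat k \<le> psi_aux n V (C - {F})" "enat k \<le> psi_aux n (?L F) (colon C F) + enat (card F - 1)"
      using Suc.prems(2) 3 F(2) by simp_all
    have "hypergraph V (C - {F})" using Suc.prems(1) by (auto simp: hypergraph_def)
    then have "extensor k (geo V (C - {F}))" using le(1) by (rule Suc.IH)
    moreover have "extensor k (geo (?L F \<union> F) (insert F (colon C F)))"
    proof -
      have hyp: "hypergraph (?L F) (colon C F)" using Suc.prems(1) F(1) by (rule colon_hypergraph)
      have "enat (k - (card F - 1)) \<le> psi_aux n (?L F) (colon C F)"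
        using le(2) by (cases "psi_aux n (?L F) (colon C F)") auto
      with hyp have "extensor (k - (card F - 1)) (geo (?L F) (colon C F))" by (rule Suc.IH)
      moreover have "finite F" "F \<noteq> {}"
        using Suc.prems(1) F(1) by (auto simp: hypergraph_def intro: finite_subset)
      ultimately have "extensor (k - (card F - 1) + (card F - 1)) (geo (?L F \<union> F) (insert F (colon C F)))"
        using hyp by (intro extensor_join_boundary) (auto simp: hypergraph_def)
      \<comment> \<open>Subtraction is truncated, so the index reached is at least \<open>k\<close>
        but may exceed it.\<close>
      then show ?thesis by (rule extensor_mono) simp
    qed
    ultimately show ?thesis using extensor_deletion[OF Suc.prems(1) F(1)] by blast
  qed
qed

subsection \<open>Spheres and discs\<close>

lemma closed_sphere_d: "closed (sphere_d d)" and closed_disc_d: "closed (disc_d d)"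
proof -
  have coord: "continuous_on UNIV (\<lambda>x :: nat \<Rightarrow> real. x j)" for j by simp
  have c: "continuous_on UNIV (\<lambda>x :: nat \<Rightarrow> real. \<Sum>j<d. (x j)\<^sup>2)"
    by (intro continuous_on_sum continuous_on_power coord)
  have "closed ((\<Inter>j\<in>{d..}. {x :: nat \<Rightarrow> real. x j = 0}) \<inter> {x. (\<Sum>j<d. (x j)\<^sup>2) = 1})"
    by (intro closed_Int closed_INT ballI closed_Collect_eq continuous_on_const coord c)
  then show "closed (sphere_d d)"
    by (rule back_subst[of closed]) (auto simp: sphere_d_def)
  have "closed ((\<Inter>j\<in>{d..}. {x :: nat \<Rightarrow> real. x j = 0}) \<inter> {x. (\<Sum>j<d. (x j)\<^sup>2) \<le> 1})"
    by (intro closed_Int closed_INT ballI closed_Collect_eq closed_Collect_le continuous_on_const coord c)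
  then show "closed (disc_d d)"
    by (rule back_subst[of closed]) (auto simp: disc_d_def)
qed

text \<open>The \<open>d\<close> coordinates alone give the dimension bound, with an empty countable
  set; compactness is inherited from a cube.\<close>

lemma thin_disc_d: "thin (Suc d) (disc_d d)"
proof -
  have "compactin (product_topology (\<lambda>i. euclidean) UNIV) (\<Pi>\<^sub>E i\<in>(UNIV :: nat set). {-1..1 :: real})"
    by (subst compactin_PiE) auto
  then have K: "compact (\<Pi>\<^sub>E i\<in>(UNIV :: nat set). {-1..1 :: real})"
    by (simp add: euclidean_product_topology)
  have "\<bar>x j\<bar> \<le> 1" if x: "x \<in> disc_d d" for x j
  proof (cases "j < d")
    case True
    then have "(x j)\<^sup>2 \<le> (\<Sum>j<d. (x j)\<^sup>2)" by (intro member_le_sum) auto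
    then have "(x j)\<^sup>2 \<le> 1" using x by (simp add: disc_d_def)
    then show ?thesis by (simp add: abs_square_le_1)
  qed (use x in \<open>auto simp: disc_d_def\<close>)
  then have "disc_d d \<subseteq> (\<Pi>\<^sub>E i\<in>UNIV. {-1..1})"
    by (auto simp: PiE_iff abs_le_iff intro: minus_le_iff[THEN iffD1])
  then have "compact (disc_d d)"
    using compact_Int_closed[OF K closed_disc_d[of d]] by (simp add: inf.absorb2)
  then show ?thesis
    unfolding thin_def by (intro conjI exI[of _ d] exI[of _ "{}"]) (auto simp: disc_d_def)
qed

lemma extensor_pi_trivial:
  assumes "extensor (i + 2) D"
  shows "pi_trivial i D"
  unfolding pi_trivial_def
proof (intro allI impI)
  fix f assume f: "continuous_map (top_of_set (sphere_d (Suc i))) (top_of_set D) f"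
  have "thin (i + 2) (disc_d (Suc i))" using thin_disc_d[of "Suc i"] by simp
  moreover have "sphere_d (Suc i) \<subseteq> disc_d (Suc i)" by (auto simp: sphere_d_def disc_d_def)
  moreover have "continuous_on (sphere_d (Suc i)) f" "f ` sphere_d (Suc i) \<subseteq> D"
    using f by (auto simp: image_subset_iff_funcset)
  ultimately obtain g where "continuous_on (disc_d (Suc i)) g" "g ` disc_d (Suc i) \<subseteq> D"
      "\<And>x. x \<in> sphere_d (Suc i) \<Longrightarrow> g x = f x"
    using extensorE[OF assms _ closed_sphere_d] by metis
  then show "\<exists>g. continuous_map (top_of_set (disc_d (Suc i))) (top_of_set D) g
      \<and> (\<forall>x\<in>sphere_d (Suc i). g x = f x)"
    by (auto simp: image_subset_iff_funcset)
qed

text \<open>The empty map extends from the empty subset to the one-point disc.\<close>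

lemma extensor_nonempty:
  assumes "extensor 1 D"
  shows "D \<noteq> {}"
proof -
  have "thin 1 (disc_d 0)" using thin_disc_d[of 0] by simp
  then obtain g where "g ` disc_d 0 \<subseteq> D"
    using extensorE[OF assms, of "disc_d 0" "{}"] by auto
  moreover have "(\<lambda>_. 0) \<in> disc_d 0" by (simp add: disc_d_def)
  ultimately show ?thesis by auto
qed

theorem theorem1p1:
  fixes V :: "'a set" and C :: "'a set set"
  assumes "hypergraph V C"
  shows "\<forall>k::int. (psi V C = \<infinity> \<or> k + 2 \<le> int (the_enat (psi V C)))
           \<longrightarrow> conn_ge V (Ind V C) k"
proof (intro allI impI)
  fix k :: int
  assume k: "psi V C = \<infinity> \<or> k + 2 \<le> int (the_enat (psi V C))"
  have ext: "extensor m (geo V C)" if "int m \<le> k + 2" for m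
  proof -
    have "enat m \<le> psi V C" using k that by (cases "psi V C") auto
    then show ?thesis using extensor_psi_aux[OF assms] unfolding psi_def by blast
  qed
  show "conn_ge V (Ind V C) k"
  proof (cases "k \<le> -2")
    case False
    \<comment> \<open>Here \<open>k \<ge> -1\<close>, so index 1 is available; degree
      \<open>i \<le> k\<close> uses index \<open>i + 2\<close>, whence the shift by 2.\<close>
    then have "geo V C \<noteq> {}" using ext[of 1] by (intro extensor_nonempty) auto
    moreover have "pi_trivial i (geo V C)" if "int i \<le> k" for i
      using ext[of "i + 2"] that by (intro extensor_pi_trivial) auto
    ultimately show ?thesis by (simp add: conn_ge_def)
  qed (simp add: conn_ge_def)
qed

end
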